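(* Let $N\ge1$, $0<s<1$, and assume $m=m_c:=\frac{N-2s}{N}>0$. Let $u(x,t)\ge0$ be the semigroup solution of the fractional porous medium equation $\partial_t u+(-\Delta)^s(u^m)=0$ in $\mathbb{R}^N\times(0,\infty)$ with initial data $u_0\in L^1(\mathbb{R}^N)$, $u_0\ge0$. Then for every $t>0$ the total mass is conserved: $$\int_{\mathbb{R}^N}u(x,t)\,dx=\int_{\mathbb{R}^N}u_0(x)\,dx .$$
   Context: The fractional Laplacian is $(-\Delta)^sf(x)=c(N,s)\,\mathrm{P.V.}\int_{\mathbb{R}^N}\frac{f(x)-f(y)}{|x-y|^{N+2s}}\,dy$ with the standard constant $c(N,s)>0$. The semigroup solution is the mild solution $u\in C([0,\infty);L^1(\mathbb{R}^N))$ with $u(0)=u_0$ obtained by the Crandall–Liggett theorem (limit of implicit time discretization) for the operator $u\mapsto(-\Delta)^s(|u|^{m-1}u)$ in $L^1(\mathbb{R}^N)$; these solutions form a semigroup of $L^1$ contractions and nonnegative data give nonnegative solutions. *)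

theory Defs
  imports "HOL-Analysis.Analysis"
begin

text \<open>The space $R^N$ is an arbitrary Euclidean space type \<open>'a\<close>, with $N$ being \<open>DIM('a)\<close>.\<close>

text \<open>The standard constant, for which the Fourier symbol of the operator is $|\xi|^{2s}$:
  $c(N,s) = 4^s\, s\, \Gamma(N/2+s) / (\pi^{N/2}\, \Gamma(1-s))$.\<close>

definition frac_lap_const :: "nat \<Rightarrow> real \<Rightarrow> real" where
  "frac_lap_const N s =
     4 powr s * s * Gamma (real N / 2 + s) / (pi powr (real N / 2) * Gamma (1 - s))"

definition frac_laplacian :: "real \<Rightarrow> ('a::euclidean_space \<Rightarrow> real) \<Rightarrow> 'a \<Rightarrow> real" where
  "frac_laplacian s f x =
     frac_lap_const DIM('a) s *
     Lim (at_right 0) (\<lambda>\<epsilon>. LINT y:{y. \<epsilon> < dist x y}|lebesgue.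
        (f x - f y) / dist x y powr (real DIM('a) + 2 * s))"

fun Ck :: "nat \<Rightarrow> ('a::euclidean_space \<Rightarrow> real) \<Rightarrow> bool" where
  "Ck 0 f \<longleftrightarrow> continuous_on UNIV f"
| "Ck (Suc k) f \<longleftrightarrow>
     (\<forall>x. f differentiable (at x)) \<and>
     (\<forall>i\<in>Basis. Ck k (\<lambda>x. frechet_derivative f (at x) i))"

definition test_function :: "('a::euclidean_space \<Rightarrow> real) \<Rightarrow> bool" where
  "test_function \<phi> \<longleftrightarrow> (\<forall>k. Ck k \<phi>) \<and> compact (closure {x. \<phi> x \<noteq> 0})"

text \<open>\<open>has_frac_laplacian s v f\<close>: the fractional Laplacian of \<open>v\<close>, in the sense of distributions,
  is the locally integrable function \<open>f\<close>. The weighted integrability of \<open>v\<close> is the usual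
  condition that makes the pairing with the fractional Laplacian of a test function, which decays
  like $|x|^{-N-2s}$, absolutely convergent.\<close>

definition has_frac_laplacian ::
  "real \<Rightarrow> ('a::euclidean_space \<Rightarrow> real) \<Rightarrow> ('a \<Rightarrow> real) \<Rightarrow> bool" where
  "has_frac_laplacian s v f \<longleftrightarrow>
     integrable lebesgue (\<lambda>x. v x / (1 + norm x) powr (real DIM('a) + 2 * s)) \<and>
     (\<forall>K. compact K \<longrightarrow> set_integrable lebesgue K f) \<and>
     (\<forall>\<phi>. test_function \<phi> \<longrightarrow>
        (LINT x|lebesgue. v x * frac_laplacian s \<phi> x) = (LINT x|lebesgue. f x * \<phi> x))"

text \<open>Since \<open>0 powr a = 0\<close>, this is $|r|^{m-1} r$ with value 0 at 0, also for \<open>m < 1\<close>.\<close>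

definition signed_power :: "real \<Rightarrow> real \<Rightarrow> real" where
  "signed_power m r = \<bar>r\<bar> powr (m - 1) * r"

text \<open>The graph of $w \mapsto (-\Delta)^s (|w|^{m-1} w)$ as an operator in $L^1$, with its maximal
  domain. Elements of $L^1$ are represented by integrable functions; the relation is invariant
  under changes on null sets.\<close>

definition fpme_operator ::
  "real \<Rightarrow> real \<Rightarrow> ('a::euclidean_space \<Rightarrow> real) \<Rightarrow> ('a \<Rightarrow> real) \<Rightarrow> bool" where
  "fpme_operator s m w f \<longleftrightarrow>
     integrable lebesgue w \<and> integrable lebesgue f \<and>
     has_frac_laplacian s (\<lambda>x. signed_power m (w x)) f"

definition L1_dist :: "('a::euclidean_space \<Rightarrow> real) \<Rightarrow> ('a \<Rightarrow> real) \<Rightarrow> real" where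
  "L1_dist f g = (LINT x|lebesgue. \<bar>f x - g x\<bar>)"

text \<open>Implicit time discretization with \<open>n\<close> steps of size \<open>h\<close>:
  $(U_k - U_{k+1})/h = (-\Delta)^s (|U_{k+1}|^{m-1} U_{k+1})$ with $U_0 = u_0$.\<close>

definition implicit_scheme ::
  "real \<Rightarrow> real \<Rightarrow> ('a::euclidean_space \<Rightarrow> real) \<Rightarrow> real \<Rightarrow> nat \<Rightarrow> (nat \<Rightarrow> 'a \<Rightarrow> real) \<Rightarrow> bool" where
  "implicit_scheme s m u0 h n U \<longleftrightarrow>
     U 0 = u0 \<and>
     (\<forall>k<n. fpme_operator s m (U (Suc k)) (\<lambda>x. (U k x - U (Suc k) x) / h))"

text \<open>The semigroup (mild) solution given by the Crandall--Liggett theorem: a continuous curve in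
  $L^1$ which on every interval \<open>{0..T}\<close> is the uniform limit in $L^1$ of the piecewise constant
  interpolants of the implicit scheme with \<open>n\<close> steps of size \<open>T / n\<close>. The interpolant equals
  \<open>U n k\<close> for \<open>t\<close> in the interval \<open>{(k - 1) * (T / n) <.. k * (T / n)}\<close>, and \<open>u0\<close> at \<open>t = 0\<close>.
  Values of \<open>u\<close> at negative times are irrelevant.\<close>

definition semigroup_solution ::
  "real \<Rightarrow> real \<Rightarrow> ('a::euclidean_space \<Rightarrow> real) \<Rightarrow> (real \<Rightarrow> 'a \<Rightarrow> real) \<Rightarrow> bool" where
  "semigroup_solution s m u0 u \<longleftrightarrow>
     (\<forall>t\<ge>0. integrable lebesgue (u t)) \<and>
     (\<forall>t\<ge>0. ((\<lambda>\<tau>. L1_dist (u \<tau>) (u t)) \<longlongrightarrow> 0) (at t within {0..})) \<and>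
     (AE x in lebesgue. u 0 x = u0 x) \<and>
     (\<forall>T>0. \<exists>U :: nat \<Rightarrow> nat \<Rightarrow> 'a \<Rightarrow> real.
        (\<forall>n\<ge>1. implicit_scheme s m u0 (T / real n) n (U n)) \<and>
        uniform_limit {0..T}
          (\<lambda>n t. L1_dist (U n (nat \<lceil>t / (T / real n)\<rceil>)) (u t)) (\<lambda>t. 0) sequentially)"

end

theory Submission
  imports Defs "HOL-Computational_Algebra.Polynomial"
begin

text \<open>Formally the mass is conserved because the integral of a fractional Laplacian is zero. The point
  is to justify this for $(-\Delta)^s(|w|^{m-1}w)$ with \<open>w\<close> merely in $L^1$, and this is done for a
  single step of the implicit scheme (\<open>integral_frac_laplacian_eq_0\<close>). Testing the equation with
  $\varphi(x/R)$ and letting $R \to \infty$, one has to show that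
  $\int |w|^m\,|(-\Delta)^s[\varphi(\cdot/R)]| \to 0$. Here
  $(-\Delta)^s[\varphi(\cdot/R)](x) = R^{-2s}\,((-\Delta)^s\varphi)(x/R)$, and for $m = (N-2s)/N$ the
  norm of this function in $L^{1/(1-m)}$, which is dual to $|w|^m \in L^{1/m}$, does not depend on $R$.
  So the integral is bounded but not obviously small. It is small because the function also tends to
  zero pointwise: mass of $|w|^m$ in a bounded region is multiplied by $R^{-2s}$, and the tail of
  $|w|^m$ is small in $L^{1/m}$. Young's inequality with a small factor
  (\<open>Young_with_small_factor\<close>) and dominated convergence make this precise.

  Every iterate of the scheme therefore has the mass of the initial datum
  (\<open>implicit_scheme_mass\<close>), and the mass passes to the $L^1$ limit that defines the solution.

  The pointwise input is that the fractional Laplacian of a test function is bounded by a multiple of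
  $(1 + |x|)^{-N-2s}$ (\<open>frac_laplacian_decay\<close>) and scales as above (\<open>frac_laplacian_scale\<close>). Both
  come from rewriting the principal value as an absolutely convergent integral of second differences
  (\<open>frac_laplacian_eq_second_difference\<close>). A test function that does not vanish at the origin is
  obtained from $e^{-1/t}$ in the usual way.\<close>

section \<open>Test functions\<close>

text \<open>Smoothness is obtained by coinduction: a class of differentiable functions that contains the
  partial derivatives of its members consists of $C^\infty$ functions. This avoids computing
  derivatives of order $k$.\<close>

lemma Ck_of_closed_class:
  fixes f :: "'a::euclidean_space \<Rightarrow> real"
  assumes "\<And>f x. F f \<Longrightarrow> f differentiable (at x)"
    and "\<And>f i. F f \<Longrightarrow> i \<in> Basis \<Longrightarrow> F (\<lambda>x. frechet_derivative f (at x) i)"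
    and "F f"
  shows "Ck k f"
  using assms(3)
proof (induction k arbitrary: f)
  case 0
  then show ?case
    using assms(1)
    by (auto intro!: differentiable_imp_continuous_on simp: differentiable_on_def)
next
  case (Suc k)
  then show ?case using assms(1,2) by auto
qed

text \<open>The functions $p(1/t)\,e^{-1/t}$, extended by zero to $t \le 0$. Allowing every polynomial \<open>p\<close>
  makes the family closed under differentiation; \<open>p = 1\<close> is the classical flat function from which
  bump functions are built.\<close>

definition flat :: "real poly \<Rightarrow> real \<Rightarrow> real" where
  "flat p t = (if t \<le> 0 then 0 else poly p (inverse t) * exp (- inverse t))"

lemma poly_times_exp_minus_tendsto_0:
  fixes p :: "real poly"
  shows "((\<lambda>y. poly p y * exp (- y)) \<longlongrightarrow> 0) at_top"
proof -
  have "((\<lambda>y. \<Sum>i\<le>degree p. coeff p i * (y ^ i / exp y)) \<longlongrightarrow> (\<Sum>i\<le>degree p. coeff p i * 0)) at_top"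
    by (intro tendsto_sum tendsto_mult tendsto_const tendsto_power_div_exp_0)
  then show ?thesis
    by (simp add: poly_altdef sum_distrib_right exp_minus divide_inverse mult.assoc)
qed

text \<open>Away from $0$ this is the product rule. At $0$ the right difference quotient is
  $y\,p(y)\,e^{-y}$ with $y = 1/t \to \infty$, so the derivative there is $0$ as well.\<close>

lemma has_real_derivative_flat:
  "(flat p has_real_derivative flat ([:0, 0, 1:] * (p - pderiv p)) t) (at t)"
proof -
  consider "t < 0" | "t = 0" | "t > 0" by linarith
  then show ?thesis
  proof cases
    case 1
    have "((\<lambda>_. 0) has_real_derivative 0) (at t)" by simp
    then have "(flat p has_real_derivative 0) (at t)"
      by (rule DERIV_cong_ev[THEN iffD1, rotated 3])
        (use 1 eventually_nhds_in_open[of "{..<0}" t] in \<open>auto simp: flat_def elim!: eventually_mono\<close>)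
    then show ?thesis using 1 by (simp add: flat_def)
  next
    case 3
    have "((\<lambda>t. poly p (inverse t) * exp (- inverse t)) has_real_derivative
        poly ([:0, 0, 1:] * (p - pderiv p)) (inverse t) * exp (- inverse t)) (at t)"
      using 3 by (auto intro!: derivative_eq_intros simp: field_simps power2_eq_square)
    then have "(flat p has_real_derivative
        poly ([:0, 0, 1:] * (p - pderiv p)) (inverse t) * exp (- inverse t)) (at t)"
      by (rule DERIV_cong_ev[THEN iffD1, rotated 3])
        (use 3 eventually_nhds_in_open[of "{0<..}" t] in \<open>auto simp: flat_def elim!: eventually_mono\<close>)
    then show ?thesis using 3 by (simp add: flat_def)
  next
    case 2
    have "((\<lambda>h. poly (pCons 0 p) (inverse h) * exp (- inverse h)) \<longlongrightarrow> 0) (at_right 0)"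
      by (rule filterlim_compose[OF poly_times_exp_minus_tendsto_0 filterlim_inverse_at_top_right])
    then have R: "((\<lambda>h. flat p h / h) \<longlongrightarrow> 0) (at_right 0)"
      by (rule tendsto_cong[THEN iffD1, rotated])
        (auto simp: flat_def eventually_at_filter divide_inverse)
    have L: "((\<lambda>h. flat p h / h) \<longlongrightarrow> 0) (at_left 0)"
      by (rule tendsto_eventually) (auto simp: flat_def eventually_at_filter)
    have "((\<lambda>h. flat p h / h) \<longlongrightarrow> 0) (at 0)"
      using L R by (rule filterlim_split_at_real)
    then show ?thesis using 2 by (simp add: has_field_derivative_iff flat_def)
  qed
qed

text \<open>The algebra generated by the coordinates and the functions \<open>flat p (1 - |x|^2)\<close>. It is closed
  under partial derivatives and contains the standard bump function of the unit ball.\<close>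

inductive bump_class :: "('a::euclidean_space \<Rightarrow> real) \<Rightarrow> bool" where
  const: "bump_class (\<lambda>x. c)"
| inner: "bump_class (\<lambda>x. x \<bullet> i)"
| flat: "bump_class (\<lambda>x. flat p (1 - x \<bullet> x))"
| add: "bump_class f \<Longrightarrow> bump_class g \<Longrightarrow> bump_class (\<lambda>x. f x + g x)"
| mult: "bump_class f \<Longrightarrow> bump_class g \<Longrightarrow> bump_class (\<lambda>x. f x * g x)"

lemma bump_class_has_derivative:
  fixes f :: "'a::euclidean_space \<Rightarrow> real"
  assumes "bump_class f"
  shows "\<exists>D. (\<forall>x. (f has_derivative D x) (at x)) \<and> (\<forall>i. bump_class (\<lambda>x. D x i))"
  using assms
proof induction
  case (const c)
  show ?case
    by (rule exI[of _ "\<lambda>_ _. 0"]) (auto intro: bump_class.const)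
next
  case (inner i)
  show ?case
    by (rule exI[of _ "\<lambda>_ h. h \<bullet> i"])
      (auto intro!: bump_class.const derivative_eq_intros)
next
  case (flat p)
  let ?q = "[:0, 0, 1:] * (p - pderiv p)"
  let ?D = "\<lambda>x h. flat ?q (1 - x \<bullet> x) * ((-2) * (x \<bullet> h))"
  have "((\<lambda>x. flat p (1 - x \<bullet> x)) has_derivative ?D x) (at x)" for x :: 'a
  proof -
    have "((\<lambda>x. 1 - x \<bullet> x) has_derivative (\<lambda>h. (-2) * (x \<bullet> h))) (at x)"
      by (auto intro!: derivative_eq_intros simp: inner_commute)
    from has_derivative_compose[OF this has_real_derivative_flat[THEN has_field_derivative_imp_has_derivative]]
    show ?thesis by simp
  qed
  moreover have "bump_class (\<lambda>x. ?D x i)" for i :: 'a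
    by (intro bump_class.intros)
  ultimately show ?case by (intro exI[of _ ?D]) blast
next
  case (add f g)
  then obtain D E where D: "\<And>x. (f has_derivative D x) (at x)" "\<And>i. bump_class (\<lambda>x. D x i)"
    and E: "\<And>x. (g has_derivative E x) (at x)" "\<And>i. bump_class (\<lambda>x. E x i)"
    by blast
  show ?case
    by (rule exI[of _ "\<lambda>x h. D x h + E x h"])
      (auto intro!: has_derivative_add bump_class.add D E)
next
  case (mult f g)
  then obtain D E where D: "\<And>x. (f has_derivative D x) (at x)" "\<And>i. bump_class (\<lambda>x. D x i)"
    and E: "\<And>x. (g has_derivative E x) (at x)" "\<And>i. bump_class (\<lambda>x. E x i)"
    by blast
  show ?case
    by (rule exI[of _ "\<lambda>x h. f x * E x h + D x h * g x"])
      (auto intro!: has_derivative_mult bump_class.add bump_class.mult mult.hyps D E)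
qed

lemma Ck_bump_class:
  fixes f :: "'a::euclidean_space \<Rightarrow> real"
  assumes "bump_class f"
  shows "Ck k f"
proof (rule Ck_of_closed_class[of bump_class])
  fix f :: "'a \<Rightarrow> real" and x i :: 'a
  assume "bump_class f"
  then obtain D where D: "\<And>x. (f has_derivative D x) (at x)" "\<And>i. bump_class (\<lambda>x. D x i)"
    using bump_class_has_derivative by blast
  show "f differentiable (at x)" using D(1) by (auto simp: differentiable_def)
  have "frechet_derivative f (at x) = D x" for x
    using frechet_derivative_at[OF D(1)] by simp
  then show "bump_class (\<lambda>x. frechet_derivative f (at x) i)" using D(2) by simp
qed fact

lemma ex_test_function_nonzero_at_0:
  "\<exists>\<phi> :: 'a::euclidean_space \<Rightarrow> real. test_function \<phi> \<and> \<phi> 0 \<noteq> 0"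
proof (intro exI conjI)
  let ?\<phi> = "\<lambda>x::'a. flat 1 (1 - x \<bullet> x)"
  have "{x. ?\<phi> x \<noteq> 0} \<subseteq> cball 0 1"
    by (auto simp: flat_def norm_le_square power2_eq_square abs_square_le_1 dot_square_norm split: if_splits)
  then show "test_function ?\<phi>"
    unfolding test_function_def
    by (auto intro!: Ck_bump_class bump_class.flat bounded_subset[OF bounded_cball])
  show "?\<phi> 0 \<noteq> 0" by (simp add: flat_def)
qed

lemma test_function_differentiable: "test_function f \<Longrightarrow> f differentiable (at x)"
  unfolding test_function_def by (metis Ck.simps(2))

lemma test_function_continuous: "test_function f \<Longrightarrow> continuous_on S f"
  by (meson differentiable_at_withinI differentiable_imp_continuous_on differentiable_on_def
      test_function_differentiable)

lemma test_function_support: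
  assumes "test_function f"
  obtains r where "r \<ge> 1" "\<And>x. norm x > r \<Longrightarrow> f x = 0"
proof -
  have "bounded {x. f x \<noteq> 0}"
    using assms unfolding test_function_def
    by (meson bounded_subset closure_subset compact_imp_bounded)
  then obtain r where "\<And>x. f x \<noteq> 0 \<Longrightarrow> norm x \<le> r"
    by (auto simp: bounded_iff)
  then show thesis
    by (intro that[of "max r 1"]) force+
qed

lemma test_function_bounded:
  fixes f :: "'a::euclidean_space \<Rightarrow> real"
  assumes "test_function f"
  obtains B where "B \<ge> 0" "\<And>x. \<bar>f x\<bar> \<le> B"
proof -
  obtain r where r: "\<And>x. norm x > r \<Longrightarrow> f x = 0"
    using test_function_support[OF assms] by metis
  have "bounded (f ` cball 0 r)"
    using assms by (intro compact_imp_bounded compact_continuous_image test_function_continuous) auto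
  then obtain B where B: "\<And>x. norm x \<le> r \<Longrightarrow> \<bar>f x\<bar> \<le> B"
    unfolding bounded_iff by fastforce
  have "\<bar>f x\<bar> \<le> max B 0" for x
    using B[of x] r[of x] by (cases "norm x \<le> r") auto
  then show thesis by (intro that[of "max B 0"]) auto
qed

text \<open>Partial derivatives stay in the class of test functions, so a bound proved for all test functions
  also holds for all their derivatives. The Lipschitz and second-order estimates below rest on this.\<close>

lemma test_function_derivative:
  fixes f :: "'a::euclidean_space \<Rightarrow> real"
  assumes f: "test_function f" and i: "i \<in> Basis"
  shows "test_function (\<lambda>x. frechet_derivative f (at x) i)"
proof -
  obtain r where r: "\<And>x. norm x > r \<Longrightarrow> f x = 0"
    using test_function_support[OF f] by metis
  have "frechet_derivative f (at x) i = 0" if "norm x > r" for x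
  proof -
    have "open {x::'a. norm x > r}"
      by (intro open_Collect_less continuous_intros)
    then have "(f has_derivative (\<lambda>_. 0)) (at x)"
      using has_derivative_transform_within_open[of "\<lambda>_. 0" "\<lambda>_. 0" x UNIV "{x. norm x > r}" f] r that
      by auto
    then show ?thesis by (simp add: frechet_derivative_at[symmetric])
  qed
  then have "{x. frechet_derivative f (at x) i \<noteq> 0} \<subseteq> cball 0 r"
    by (force simp: not_less[symmetric])
  moreover have "Ck k (\<lambda>x. frechet_derivative f (at x) i)" for k
    using f i unfolding test_function_def by (metis Ck.simps(2))
  ultimately show ?thesis
    unfolding test_function_def by (auto intro!: bounded_subset[OF bounded_cball])
qed

lemma frechet_derivative_basis_sum:
  fixes f :: "'a::euclidean_space \<Rightarrow> real"
  assumes "f differentiable (at x)"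
  shows "frechet_derivative f (at x) h = (\<Sum>i\<in>Basis. (h \<bullet> i) * frechet_derivative f (at x) i)"
proof -
  interpret linear "frechet_derivative f (at x)"
    using assms by (rule linear_frechet_derivative)
  have "frechet_derivative f (at x) h = frechet_derivative f (at x) (\<Sum>i\<in>Basis. (h \<bullet> i) *\<^sub>R i)"
    by (simp add: euclidean_representation)
  also have "\<dots> = (\<Sum>i\<in>Basis. (h \<bullet> i) * frechet_derivative f (at x) i)"
    by (simp add: sum scale)
  finally show ?thesis .
qed

text \<open>The gradient is bounded, since its components are test functions.\<close>

lemma test_function_Lipschitz:
  fixes f :: "'a::euclidean_space \<Rightarrow> real"
  assumes f: "test_function f"
  obtains L where "L \<ge> 0" "\<And>x y. \<bar>f x - f y\<bar> \<le> L * norm (x - y)"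
proof -
  have "\<forall>i\<in>Basis. \<exists>B\<ge>0. \<forall>x. \<bar>frechet_derivative f (at x) i\<bar> \<le> B"
    using test_function_bounded[OF test_function_derivative[OF f]] by metis
  then obtain B where B: "\<And>i. i \<in> Basis \<Longrightarrow> B i \<ge> 0"
      "\<And>i x. i \<in> Basis \<Longrightarrow> \<bar>frechet_derivative f (at x) i\<bar> \<le> B i"
    by metis
  have "onorm (frechet_derivative f (at x)) \<le> (\<Sum>i\<in>Basis. B i)" for x
  proof (rule onorm_le)
    fix h :: 'a
    have "norm (frechet_derivative f (at x) h) \<le> (\<Sum>i\<in>Basis. \<bar>h \<bullet> i\<bar> * \<bar>frechet_derivative f (at x) i\<bar>)"
      using sum_abs[of "\<lambda>i. (h \<bullet> i) * frechet_derivative f (at x) i" Basis]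
      by (simp add: frechet_derivative_basis_sum[OF test_function_differentiable[OF f], of x h] abs_mult)
    also have "\<dots> \<le> (\<Sum>i\<in>Basis. norm h * B i)"
      by (intro sum_mono mult_mono B) (auto simp: Basis_le_norm)
    finally show "norm (frechet_derivative f (at x) h) \<le> (\<Sum>i\<in>Basis. B i) * norm h"
      by (simp add: sum_distrib_left mult.commute)
  qed
  then have "norm (f x - f y) \<le> (\<Sum>i\<in>Basis. B i) * norm (x - y)" for x y
    using test_function_differentiable[OF f]
    by (intro differentiable_bound[of UNIV f "\<lambda>x. frechet_derivative f (at x)"])
      (auto simp: frechet_derivative_works[symmetric])
  then show thesis
    by (intro that[of "\<Sum>i\<in>Basis. B i"]) (auto intro!: sum_nonneg B)
qed

text \<open>The symmetric numerator in the fractional Laplacian. For smooth \<open>f\<close> it is quadratically small in \<open>h\<close>, which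
  turns the principal value into an absolutely convergent integral.\<close>

definition second_difference :: "('a::real_vector \<Rightarrow> real) \<Rightarrow> 'a \<Rightarrow> 'a \<Rightarrow> real" where
  "second_difference f x h = 2 * f x - f (x + h) - f (x - h)"

text \<open>By the mean value theorem along the segment from \<open>0\<close> to \<open>h\<close>, the second difference is a
  difference of directional derivatives at two points at distance at most \<open>2 * |h|\<close>, and the partial
  derivatives are Lipschitz.\<close>

lemma second_difference_le_square:
  fixes f :: "'a::euclidean_space \<Rightarrow> real"
  assumes f: "test_function f"
  obtains C where "C \<ge> 0" "\<And>x h. \<bar>second_difference f x h\<bar> \<le> C * (norm h)\<^sup>2"
proof -
  let ?D = "\<lambda>i x. frechet_derivative f (at x) i"
  have "\<forall>i\<in>Basis. \<exists>L\<ge>0. \<forall>x y. \<bar>?D i x - ?D i y\<bar> \<le> L * norm (x - y)"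
    using test_function_Lipschitz[OF test_function_derivative[OF f]] by metis
  then obtain L where L: "\<And>i. i \<in> Basis \<Longrightarrow> L i \<ge> 0"
      "\<And>i x y. i \<in> Basis \<Longrightarrow> \<bar>?D i x - ?D i y\<bar> \<le> L i * norm (x - y)"
    by metis
  have "\<bar>second_difference f x h\<bar> \<le> (\<Sum>i\<in>Basis. 2 * L i) * (norm h)\<^sup>2" for x h
  proof -
    let ?w = "\<lambda>t. f (x + t *\<^sub>R h) + f (x - t *\<^sub>R h)"
    let ?w' = "\<lambda>t. \<Sum>i\<in>Basis. (h \<bullet> i) * (?D i (x + t *\<^sub>R h) - ?D i (x - t *\<^sub>R h))"
    have df: "(f has_derivative frechet_derivative f (at y)) (at y)" for y
      using test_function_differentiable[OF f] by (simp add: frechet_derivative_works[symmetric])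
    have "(?w has_real_derivative ?w' t) (at t)" for t
    proof -
      have 1: "((\<lambda>t. f (x + t *\<^sub>R h)) has_derivative
          (\<lambda>k. frechet_derivative f (at (x + t *\<^sub>R h)) (k *\<^sub>R h))) (at t)"
        by (rule has_derivative_compose[OF _ df]) (auto intro!: derivative_eq_intros)
      have 2: "((\<lambda>t. f (x - t *\<^sub>R h)) has_derivative
          (\<lambda>k. frechet_derivative f (at (x - t *\<^sub>R h)) (- (k *\<^sub>R h)))) (at t)"
        by (rule has_derivative_compose[OF _ df]) (auto intro!: derivative_eq_intros)
      have eq: "frechet_derivative f (at (x + t *\<^sub>R h)) (k *\<^sub>R h)
          + frechet_derivative f (at (x - t *\<^sub>R h)) (- (k *\<^sub>R h)) = ?w' t * k" for k
        unfolding frechet_derivative_basis_sum[OF test_function_differentiable[OF f], of _ "k *\<^sub>R h"]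
          frechet_derivative_basis_sum[OF test_function_differentiable[OF f], of _ "- (k *\<^sub>R h)"]
        by (simp add: sum_distrib_left sum.distrib[symmetric] algebra_simps)
      show ?thesis
        unfolding has_field_derivative_def
        using has_derivative_add[OF 1 2] by (simp add: eq)
    qed
    then obtain \<xi> where "\<xi> > 0" "\<xi> < 1" "?w 1 - ?w 0 = ?w' \<xi>"
      using MVT2[of 0 1 ?w ?w'] by auto
    then have "\<bar>second_difference f x h\<bar> = \<bar>?w' \<xi>\<bar>"
      by (simp add: second_difference_def)
    also have "\<dots> \<le> (\<Sum>i\<in>Basis. \<bar>h \<bullet> i\<bar> * \<bar>?D i (x + \<xi> *\<^sub>R h) - ?D i (x - \<xi> *\<^sub>R h)\<bar>)"
      by (rule order_trans[OF sum_abs]) (simp add: abs_mult)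
    also have "\<dots> \<le> (\<Sum>i\<in>Basis. norm h * (L i * (2 * norm h)))"
    proof (intro sum_mono mult_mono)
      fix i :: 'a assume i: "i \<in> Basis"
      have "(x + \<xi> *\<^sub>R h) - (x - \<xi> *\<^sub>R h) = (2 * \<xi>) *\<^sub>R h"
        by (simp add: scaleR_2 flip: scaleR_scaleR)
      then have "norm ((x + \<xi> *\<^sub>R h) - (x - \<xi> *\<^sub>R h)) \<le> 2 * norm h"
        using \<open>\<xi> > 0\<close> \<open>\<xi> < 1\<close> by (simp add: mult_left_le_one_le)
      then show "\<bar>?D i (x + \<xi> *\<^sub>R h) - ?D i (x - \<xi> *\<^sub>R h)\<bar> \<le> L i * (2 * norm h)"
        using L(2)[OF i] mult_left_mono[OF _ L(1)[OF i]] order_trans by blast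
    qed (auto simp: Basis_le_norm)
    also have "\<dots> = (\<Sum>i\<in>Basis. 2 * L i) * (norm h)\<^sup>2"
      by (simp add: sum_distrib_left power2_eq_square algebra_simps)
    finally show ?thesis .
  qed
  then show thesis
    by (intro that[of "\<Sum>i\<in>Basis. 2 * L i"]) (auto intro!: sum_nonneg L)
qed

lemma Ck_scale:
  fixes f :: "'a::euclidean_space \<Rightarrow> real"
  assumes "Ck k f"
  shows "Ck k (\<lambda>x. a * f (c *\<^sub>R x))"
  using assms
proof (induction k arbitrary: f a)
  case 0
  then show ?case
    by (auto intro!: continuous_intros continuous_on_compose2[of UNIV f])
next
  case (Suc k)
  have D: "((\<lambda>x. a * f (c *\<^sub>R x)) has_derivative
      (\<lambda>h. a * (c * frechet_derivative f (at (c *\<^sub>R x)) h))) (at x)" for x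
  proof -
    have "(f has_derivative frechet_derivative f (at (c *\<^sub>R x))) (at (c *\<^sub>R x))"
      using Suc.prems by (simp add: frechet_derivative_works[symmetric])
    then have "((\<lambda>x. f (c *\<^sub>R x)) has_derivative (\<lambda>h. frechet_derivative f (at (c *\<^sub>R x)) (c *\<^sub>R h))) (at x)"
      by (rule has_derivative_compose[rotated]) (auto intro!: derivative_eq_intros)
    moreover have "linear (frechet_derivative f (at (c *\<^sub>R x)))"
      using Suc.prems by (auto intro!: linear_frechet_derivative)
    ultimately show ?thesis
      by (auto intro!: derivative_eq_intros simp: linear_scale)
  qed
  have "Ck k (\<lambda>x. (a * c) * frechet_derivative f (at (c *\<^sub>R x)) i)" if "i \<in> Basis" for i
    using Suc.IH[of "\<lambda>x. frechet_derivative f (at x) i"] Suc.prems that by simp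
  then show ?case
    using D by (auto simp: differentiable_def frechet_derivative_at[OF D, symmetric] mult.assoc)
qed

lemma test_function_scale:
  fixes f :: "'a::euclidean_space \<Rightarrow> real"
  assumes f: "test_function f" and c: "c > 0"
  shows "test_function (\<lambda>x. f (c *\<^sub>R x))"
proof -
  obtain r where r: "\<And>x. norm x > r \<Longrightarrow> f x = 0"
    using test_function_support[OF f] by metis
  have "norm x \<le> r / c" if "f (c *\<^sub>R x) \<noteq> 0" for x
    using r[of "c *\<^sub>R x"] that c by (auto simp: field_simps not_less[symmetric])
  then have "bounded {x. f (c *\<^sub>R x) \<noteq> 0}"
    by (auto simp: bounded_iff)
  then show ?thesis
    using f Ck_scale[of _ f 1 c] unfolding test_function_def by simp
qed

section \<open>Integrals over Euclidean space\<close>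

lemma lborel_integral_affine:
  fixes f :: "'a::euclidean_space \<Rightarrow> real" and t :: 'a
  assumes [measurable]: "f \<in> borel_measurable borel" and c: "c \<noteq> 0"
  shows "integral\<^sup>L lborel f = \<bar>c\<bar> ^ DIM('a) * (\<integral>x. f (t + c *\<^sub>R x) \<partial>lborel)"
proof -
  have "integral\<^sup>L lborel f
      = integral\<^sup>L (density (distr lborel borel (\<lambda>x. t + c *\<^sub>R x)) (\<lambda>_. ennreal (\<bar>c\<bar>^DIM('a)))) f"
    using lborel_affine[OF c, of t] by simp
  also have "\<dots> = (\<integral>x. \<bar>c\<bar>^DIM('a) * f (t + c *\<^sub>R x) \<partial>lborel)"
    by (subst integral_density) (simp_all add: integral_distr)
  finally show ?thesis by simp
qed

lemma lborel_integrable_affine: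
  fixes f :: "'a::euclidean_space \<Rightarrow> real" and t :: 'a
  assumes f: "integrable lborel f" and c: "c \<noteq> 0"
  shows "integrable lborel (\<lambda>x. f (t + c *\<^sub>R x))"
proof -
  have [measurable]: "f \<in> borel_measurable borel" using f by auto
  have "integrable (density (distr lborel borel (\<lambda>x. t + c *\<^sub>R x)) (\<lambda>_. ennreal (\<bar>c\<bar>^DIM('a)))) f"
    using f lborel_affine[OF c, of t] by simp
  then have "integrable lborel (\<lambda>x. \<bar>c\<bar>^DIM('a) * f (t + c *\<^sub>R x))"
    by (subst (asm) integrable_density) (simp_all add: integrable_distr_eq)
  then show ?thesis using c by simp
qed

text \<open>Both radial integrability criteria at once: \<open>\<sigma> = 1\<close> is the region $|h| \ge 1$, where $q > N$
  is required, and \<open>\<sigma> = -1\<close> the region $|h| \le 1$, where $q < N$ is required. The region is cut into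
  shells whose radii form a geometric sequence; the volume of a ball of radius $r$ is a multiple of
  $r^N$, so the contributions of the shells are dominated by a convergent geometric series.\<close>

lemma integrable_norm_powr:
  fixes q \<sigma> :: real
  assumes \<sigma>: "\<sigma> = 1 \<or> \<sigma> = -1" and q: "\<sigma> * (real DIM('a) - q) < 0"
  shows "integrable lborel
    (\<lambda>h::'a::euclidean_space. indicator {h. 0 \<le> \<sigma> * ln (norm h)} h * norm h powr (- q))"
    (is "integrable lborel ?f")
proof (rule integrableI_nonneg)
  let ?n = "real DIM('a)"
  let ?\<theta> = "exp (\<sigma> * (?n - q))"
  define c where "c k = exp (\<bar>q\<bar> - q * \<sigma> * real k)" for k :: nat
  define B where "B k = cball (0::'a) (exp (\<sigma> * real k + 1))" for k :: nat
  have [measurable]: "B k \<in> sets borel" for k by (simp add: B_def borel_closed)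
  have vol: "ennreal (c k) * emeasure lborel (B k)
      = ennreal (exp (\<bar>q\<bar> + ?n) * unit_ball_vol ?n * ?\<theta> ^ k)" for k
  proof -
    have "exp (\<sigma> * real k + 1) ^ DIM('a) = exp (?n * (\<sigma> * real k + 1))"
      by (simp add: exp_of_nat_mult)
    moreover have "?\<theta> ^ k = exp (real k * (\<sigma> * (?n - q)))"
      by (simp add: exp_of_nat_mult)
    moreover have "exp (\<bar>q\<bar> - q * \<sigma> * real k) * exp (?n * (\<sigma> * real k + 1))
        = exp (\<bar>q\<bar> + ?n) * exp (real k * (\<sigma> * (?n - q)))"
      by (simp add: exp_add[symmetric] algebra_simps)
    ultimately show ?thesis
      by (simp add: c_def B_def emeasure_cball ennreal_mult'[symmetric] mult_ac)
  qed
  have bound: "ennreal (?f h) \<le> (\<Sum>k. ennreal (c k) * indicator (B k) h)" for h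
  proof (cases "h \<noteq> 0 \<and> 0 \<le> \<sigma> * ln (norm h)")
    case True
    \<comment> \<open>the index of the shell that contains \<open>h\<close>, with \<open>t\<close> the logarithmic position inside it\<close>
    define k where "k = nat \<lfloor>\<sigma> * ln (norm h)\<rfloor>"
    define t where "t = \<sigma> * ln (norm h) - real k"
    have t: "0 \<le> t" "t \<le> 1" using True unfolding k_def t_def by linarith+
    have ln: "ln (norm h) = \<sigma> * real k + \<sigma> * t"
      using \<sigma> by (auto simp: t_def)
    have nh: "norm h = exp (\<sigma> * real k + \<sigma> * t)"
      using True by (simp flip: ln)
    have "h \<in> B k"
      using \<sigma> t by (auto simp: B_def nh)
    moreover have "?f h \<le> c k"
    proof -
      have "- q * (\<sigma> * t) \<le> \<bar>q\<bar>"
        using \<sigma> t mult_left_le[of t "\<bar>q\<bar>"] by (auto simp: abs_if mult_nonneg_nonneg split: if_splits)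
          (smt (verit) mult_nonneg_nonneg mult_nonpos_nonneg)+
      then show ?thesis
        using True by (simp add: powr_def ln c_def algebra_simps)
    qed
    ultimately have "ennreal (?f h) \<le> ennreal (c k) * indicator (B k) h"
      by (simp add: ennreal_leI)
    also have "\<dots> \<le> (\<Sum>k. ennreal (c k) * indicator (B k) h)"
      using sum_le_suminf[of "\<lambda>k. ennreal (c k) * indicator (B k) h" "{k}"]
      by (simp del: sum_mult_indicator)
    finally show ?thesis .
  next
    case False
    then have "?f h = 0" by (auto simp: indicator_def)
    then show ?thesis by (simp only: ennreal_0 zero_le)
  qed
  have "(\<integral>\<^sup>+h. ennreal (?f h) \<partial>lborel) \<le> (\<integral>\<^sup>+h. (\<Sum>k. ennreal (c k) * indicator (B k) h) \<partial>lborel)"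
    by (intro nn_integral_mono bound)
  also have "\<dots> = (\<Sum>k. \<integral>\<^sup>+h. ennreal (c k) * indicator (B k) h \<partial>lborel)"
    by (intro nn_integral_suminf) measurable
  also have "\<dots> = (\<Sum>k. ennreal (exp (\<bar>q\<bar> + ?n) * unit_ball_vol ?n * ?\<theta> ^ k))"
    by (subst nn_integral_cmult) (simp_all flip: vol)
  also have "\<dots> < \<infinity>"
    using q by (subst suminf_ennreal2) (auto intro!: summable_mult summable_geometric)
  finally show "(\<integral>\<^sup>+h. ennreal (?f h) \<partial>lborel) < \<infinity>" .
qed (auto simp: indicator_def)

text \<open>Near the origin the factor $|h|^2$ lowers the exponent to $N + 2s - 2 < N$; at infinity the
  exponent is $N + 2s > N$.\<close>

lemma integrable_levy_kernel:
  fixes s :: real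
  assumes "0 < s" "s < 1"
  shows "integrable lborel
    (\<lambda>h::'a::euclidean_space. min 1 ((norm h)\<^sup>2) * norm h powr (- (real DIM('a) + 2 * s)))"
proof (rule Bochner_Integration.integrable_bound)
  let ?q = "real DIM('a) + 2 * s"
  let ?g = "\<lambda>h::'a. indicator {h. 0 \<le> 1 * ln (norm h)} h * norm h powr (- ?q)
      + indicator {h. 0 \<le> (-1) * ln (norm h)} h * norm h powr (- (?q - 2))"
  show "integrable lborel ?g"
    using assms by (intro Bochner_Integration.integrable_add integrable_norm_powr) auto
  show "AE h in lborel. norm (min 1 ((norm h)\<^sup>2) * norm h powr (- ?q)) \<le> norm (?g h)"
  proof (intro always_eventually allI)
    fix h :: 'a
    consider "h = 0" | "h \<noteq> 0" "norm h \<le> 1" | "norm h > 1" by fastforce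
    then show "norm (min 1 ((norm h)\<^sup>2) * norm h powr (- ?q)) \<le> norm (?g h)"
    proof cases
      case 2
      have "min 1 ((norm h)\<^sup>2) * norm h powr (- ?q) \<le> (norm h)\<^sup>2 * norm h powr (- ?q)"
        by (intro mult_right_mono) auto
      also have "\<dots> = norm h powr (- (?q - 2))"
        using 2 powr_add[of "norm h" 2 "- ?q"] by (simp add: algebra_simps)
      finally show ?thesis using 2 by (auto simp: indicator_def)
    next
      case 3
      then show ?thesis by (auto simp: indicator_def)
    qed auto
  qed
qed simp

lemma integrable_decay:
  fixes s :: real
  assumes "0 < s" "s < 1"
  shows "integrable lborel (\<lambda>x::'a::euclidean_space. (1 + norm x) powr (- (real DIM('a) + 2 * s)))"
proof (rule Bochner_Integration.integrable_bound)
  let ?q = "real DIM('a) + 2 * s"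
  let ?g = "\<lambda>x::'a. indicator (cball 0 1) x + min 1 ((norm x)\<^sup>2) * norm x powr (- ?q)"
  show "integrable lborel ?g"
    using assms by (intro Bochner_Integration.integrable_add integrable_levy_kernel
        integrable_real_indicator)
      (auto simp: emeasure_cball)
  have "(1 + norm x) powr (- ?q) \<le> ?g x" for x :: 'a
  proof (cases "norm x \<le> 1")
    case True
    have "(1 + norm x) powr (- ?q) \<le> 1"
      using assms powr_mono[of "- ?q" 0 "1 + norm x"] by (auto split: if_splits)
    then show ?thesis using True by (auto intro: add_increasing2)
  next
    case False
    then have "(norm x)\<^sup>2 \<ge> 1" by (simp add: one_le_power)
    moreover have "(1 + norm x) powr (- ?q) \<le> norm x powr (- ?q)"
      using assms False by (intro powr_mono2') auto
    ultimately show ?thesis using False by simp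
  qed
  then show "AE x in lborel. norm ((1 + norm x) powr (- ?q)) \<le> norm (?g x)"
    by (intro always_eventually allI) (auto intro: order_trans)
qed simp

section \<open>The fractional Laplacian of a test function\<close>

lemma test_function_borel_measurable [measurable_dest]:
  fixes f :: "'a::euclidean_space \<Rightarrow> real"
  shows "test_function f \<Longrightarrow> f \<in> borel_measurable borel"
  by (intro borel_measurable_continuous_onI test_function_continuous)

lemma test_function_integrable:
  fixes f :: "'a::euclidean_space \<Rightarrow> real"
  assumes "test_function f"
  shows "integrable lborel f"
proof -
  obtain r where r: "\<And>x. norm x > r \<Longrightarrow> f x = 0"
    using test_function_support[OF assms] by metis
  have "set_integrable lborel (cball 0 r) f"
    unfolding set_integrable_def using assms
    by (intro borel_integrable_compact test_function_continuous) auto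
  moreover have "(\<lambda>x. indicator (cball 0 r) x *\<^sub>R f x) = f"
    using r by (auto simp: fun_eq_iff indicator_def)
  ultimately show ?thesis by (simp add: set_integrable_def)
qed

lemma second_difference_le_min:
  fixes f :: "'a::euclidean_space \<Rightarrow> real"
  assumes f: "test_function f"
  obtains C where "C \<ge> 0" "\<And>x h. \<bar>second_difference f x h\<bar> \<le> C * min 1 ((norm h)\<^sup>2)"
proof -
  obtain C where C: "C \<ge> 0" "\<And>x h. \<bar>second_difference f x h\<bar> \<le> C * (norm h)\<^sup>2"
    using second_difference_le_square[OF f] by metis
  obtain B where B: "B \<ge> 0" "\<And>x. \<bar>f x\<bar> \<le> B"
    using test_function_bounded[OF f] by metis
  have "\<bar>second_difference f x h\<bar> \<le> max C (4 * B) * min 1 ((norm h)\<^sup>2)" for x h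
  proof -
    have "\<bar>second_difference f x h\<bar> \<le> 4 * B"
      using B(2)[of x] B(2)[of "x + h"] B(2)[of "x - h"] by (simp add: second_difference_def)
    moreover have "\<bar>second_difference f x h\<bar> \<le> max C (4 * B) * (norm h)\<^sup>2"
      by (rule order_trans[OF C(2)]) (simp add: mult_right_mono)
    ultimately show ?thesis by (auto simp: min_def)
  qed
  then show thesis using C(1) by (intro that[of "max C (4 * B)"]) auto
qed

text \<open>The truncated integral over $|y - x| > \varepsilon$ is absolutely convergent, and averaging it with
  its image under $h \mapsto -h$, where $y = x + h$, replaces $f(x) - f(x + h)$ by half the second
  difference. The latter is dominated by the integrable kernel $\min(1, |h|^2)\,|h|^{-N-2s}$, so the
  limit $\varepsilon \to 0$ exists by dominated convergence.\<close>

lemma frac_laplacian_eq_second_difference: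
  fixes f :: "'a::euclidean_space \<Rightarrow> real"
  assumes s: "0 < s" "s < 1" and f: "test_function f"
  shows "frac_laplacian s f x = frac_lap_const DIM('a) s / 2 *
    (\<integral>h. second_difference f x h * norm h powr (- (real DIM('a) + 2 * s)) \<partial>lborel)"
proof -
  let ?q = "real DIM('a) + 2 * s"
  let ?k = "\<lambda>h::'a. norm h powr (- ?q)"
  let ?I = "\<lambda>\<epsilon>. LINT y:{y. \<epsilon> < dist x y}|lebesgue. (f x - f y) / dist x y powr ?q"
  let ?J = "\<integral>h. second_difference f x h * ?k h \<partial>lborel"
  let ?S = "\<lambda>\<epsilon> h. indicator {h. \<epsilon> < norm h} h * (second_difference f x h * ?k h)"
  have [measurable]: "f \<in> borel_measurable borel" using f by measurable
  have m: "(\<lambda>h. second_difference f x h) \<in> borel_measurable borel"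
    unfolding second_difference_def by measurable
  note [measurable] = m
  obtain C where C: "C \<ge> 0" "\<And>x h. \<bar>second_difference f x h\<bar> \<le> C * min 1 ((norm h)\<^sup>2)"
    using second_difference_le_min[OF f] by metis
  obtain B where B: "B \<ge> 0" "\<And>x. \<bar>f x\<bar> \<le> B"
    using test_function_bounded[OF f] by metis
  have w: "integrable lborel (\<lambda>h::'a. C * (min 1 ((norm h)\<^sup>2) * ?k h))"
    using integrable_levy_kernel[OF s, where 'a = 'a] by simp
  have Cw: "\<bar>second_difference f x h * ?k h\<bar> \<le> C * (min 1 ((norm h)\<^sup>2) * ?k h)" for h
    using mult_right_mono[OF C(2)[of x h], of "?k h"] by (simp add: abs_mult mult.assoc)
  have I: "?I \<epsilon> = (\<integral>h. ?S \<epsilon> h \<partial>lborel) / 2" if \<epsilon>: "\<epsilon> > 0" for \<epsilon>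
  proof -
    \<comment> \<open>the truncated integrand, translated so that the singularity is at the origin\<close>
    define g where "g h = indicator {h. \<epsilon> < norm h} h * ((f x - f (x + h)) * ?k h)" for h
    have [measurable]: "g \<in> borel_measurable borel" unfolding g_def by measurable
    have "?I \<epsilon> = (\<integral>y. indicator {y. \<epsilon> < dist x y} y *\<^sub>R ((f x - f y) / dist x y powr ?q) \<partial>lborel)"
      unfolding set_lebesgue_integral_def by (subst integral_completion) auto
    also have "\<dots> = (\<integral>h. indicator {y. \<epsilon> < dist x y} (x + 1 *\<^sub>R h) *\<^sub>R
        ((f x - f (x + 1 *\<^sub>R h)) / dist x (x + 1 *\<^sub>R h) powr ?q) \<partial>lborel)"
      by (subst lborel_integral_affine[where t = x and c = 1]) auto
    also have "\<dots> = integral\<^sup>L lborel g"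
      by (intro Bochner_Integration.integral_cong)
        (auto simp: g_def indicator_def dist_norm powr_minus divide_inverse
          simp del: minus_add_distrib)
    finally have Ig: "?I \<epsilon> = integral\<^sup>L lborel g" .
    have g_int: "integrable lborel g"
    proof (rule Bochner_Integration.integrable_bound)
      let ?M = "2 * B / min 1 (\<epsilon>\<^sup>2)"
      show "integrable lborel (\<lambda>h::'a. ?M * (min 1 ((norm h)\<^sup>2) * ?k h))"
        using integrable_levy_kernel[OF s, where 'a = 'a] by simp
      have "\<bar>g h\<bar> \<le> ?M * (min 1 ((norm h)\<^sup>2) * ?k h)" for h
      proof (cases "\<epsilon> < norm h")
        case True
        have "min 1 (\<epsilon>\<^sup>2) \<le> min 1 ((norm h)\<^sup>2)"
          using True \<epsilon> by (intro min.mono power_mono) auto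
        then have "2 * B \<le> ?M * min 1 ((norm h)\<^sup>2)"
          using B(1) \<epsilon> by (simp add: pos_le_divide_eq mult_left_mono)
        moreover have "\<bar>f x - f (x + h)\<bar> \<le> 2 * B"
          using B(2)[of x] B(2)[of "x + h"] by linarith
        ultimately have "\<bar>f x - f (x + h)\<bar> \<le> ?M * min 1 ((norm h)\<^sup>2)" by linarith
        from mult_right_mono[OF this, of "?k h"] show ?thesis
          using True by (simp add: g_def abs_mult mult.assoc)
      qed (use B(1) \<epsilon> in \<open>simp add: g_def\<close>)
      then show "AE h in lborel. norm (g h) \<le> norm (?M * (min 1 ((norm h)\<^sup>2) * ?k h))"
        by (intro always_eventually allI) (metis abs_ge_self order_trans real_norm_def)
    qed simp
    have "2 * integral\<^sup>L lborel g = integral\<^sup>L lborel g + (\<integral>h. g (0 + (-1) *\<^sub>R h) \<partial>lborel)"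
      by (subst (3) lborel_integral_affine[where t = 0 and c = "-1"]) auto
    also have "\<dots> = (\<integral>h. g h + g (0 + (-1) *\<^sub>R h) \<partial>lborel)"
      using lborel_integrable_affine[OF g_int, of "-1" 0] g_int
      by (subst Bochner_Integration.integral_add) auto
    also have "\<dots> = (\<integral>h. ?S \<epsilon> h \<partial>lborel)"
      by (intro Bochner_Integration.integral_cong)
        (auto simp: g_def indicator_def second_difference_def algebra_simps)
    finally show ?thesis using Ig by simp
  qed
  have "(?I \<longlongrightarrow> ?J / 2) (at_right 0)"
  proof (rule tendsto_at_right_sequentially[of 0 1])
    fix \<epsilon> :: "nat \<Rightarrow> real"
    assume pos: "\<And>n. 0 < \<epsilon> n" and lim: "\<epsilon> \<longlonglongrightarrow> 0"
    have "(\<lambda>n. \<integral>h. ?S (\<epsilon> n) h \<partial>lborel) \<longlonglongrightarrow> ?J"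
    proof (rule integral_dominated_convergence[OF _ _ w])
      show "AE h in lborel. (\<lambda>n. ?S (\<epsilon> n) h) \<longlonglongrightarrow> second_difference f x h * ?k h"
      proof (intro always_eventually allI)
        fix h :: 'a
        show "(\<lambda>n. ?S (\<epsilon> n) h) \<longlonglongrightarrow> second_difference f x h * ?k h"
        proof (cases "h = 0")
          case False
          then have "eventually (\<lambda>n. \<epsilon> n < norm h) sequentially"
            using lim by (intro order_tendstoD) auto
          then show ?thesis
            by (intro tendsto_eventually, elim eventually_mono) simp
        qed simp
      qed
      show "AE h in lborel. norm (?S (\<epsilon> n) h) \<le> C * (min 1 ((norm h)\<^sup>2) * ?k h)" for n
        using Cw order_trans[OF abs_ge_zero Cw]
        by (intro always_eventually allI) (auto simp: indicator_def)
    qed auto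
    then show "(\<lambda>n. ?I (\<epsilon> n)) \<longlonglongrightarrow> ?J / 2"
      unfolding I[OF pos] by (intro tendsto_intros) auto
  qed simp
  then have "Lim (at_right 0) ?I = ?J / 2"
    by (intro tendsto_Lim) auto
  then show ?thesis by (simp add: frac_laplacian_def)
qed

text \<open>Let \<open>r\<close> bound the support of \<open>f\<close>. For $|x| \le 2r$ the second difference is dominated by a
  multiple of the integrable kernel, uniformly in \<open>x\<close>. For $|x| > 2r$ it vanishes unless $x + h$ or
  $x - h$ lies in the support, which forces $|h| \ge |x|/2$; the kernel is then at most a multiple of
  $(1 + |x|)^{-N-2s}$, and what remains is integrated to twice the $L^1$ norm of \<open>f\<close>.\<close>

lemma frac_laplacian_decay:
  fixes f :: "'a::euclidean_space \<Rightarrow> real"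
  assumes s: "0 < s" "s < 1" and f: "test_function f"
  obtains A where "A \<ge> 0"
    "\<And>x. \<bar>frac_laplacian s f x\<bar> \<le> A * (1 + norm x) powr (- (real DIM('a) + 2 * s))"
proof -
  let ?q = "real DIM('a) + 2 * s"
  let ?k = "\<lambda>h::'a. norm h powr (- ?q)"
  let ?c = "\<bar>frac_lap_const DIM('a) s\<bar>"
  have [measurable]: "f \<in> borel_measurable borel" using f by measurable
  obtain r where r: "r \<ge> 1" "\<And>x. norm x > r \<Longrightarrow> f x = 0"
    using test_function_support[OF f] by metis
  obtain C where C: "C \<ge> 0" "\<And>x h. \<bar>second_difference f x h\<bar> \<le> C * min 1 ((norm h)\<^sup>2)"
    using second_difference_le_min[OF f] by metis
  define K where "K = integral\<^sup>L lborel (\<lambda>h::'a. C * (min 1 ((norm h)\<^sup>2) * ?k h))"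
  define M where "M = (\<integral>y. \<bar>f y\<bar> \<partial>lborel)"
  have "K \<ge> 0" "M \<ge> 0" unfolding K_def M_def using C(1) by (auto intro!: integral_nonneg_AE)
  \<comment> \<open>any integrable majorant \<open>w\<close> of the symmetrized integrand controls the fractional Laplacian\<close>
  have fl: "\<bar>frac_laplacian s f x\<bar> \<le> ?c * (\<integral>h. w h \<partial>lborel)"
    if w: "integrable lborel w" "\<And>h. \<bar>second_difference f x h * ?k h\<bar> \<le> w h" for x w
  proof -
    have "\<bar>\<integral>h. second_difference f x h * ?k h \<partial>lborel\<bar> \<le> (\<integral>h. w h \<partial>lborel)"
    proof -
      have "integrable lborel (\<lambda>h. second_difference f x h * ?k h)"
        by (rule Bochner_Integration.integrable_bound[OF w(1)])
          (auto simp: second_difference_def[abs_def] simp del: minus_add_distrib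
            intro!: always_eventually order_trans[OF w(2)[unfolded second_difference_def]])
      from Bochner_Integration.integral_abs_bound_integral[OF this w(1)] w(2)
      show ?thesis by blast
    qed
    moreover have "0 \<le> (\<integral>h. w h \<partial>lborel)"
      by (intro integral_nonneg_AE always_eventually allI order_trans[OF abs_ge_zero w(2)])
    ultimately have "?c / 2 * \<bar>\<integral>h. second_difference f x h * ?k h \<partial>lborel\<bar> \<le> ?c * (\<integral>h. w h \<partial>lborel)"
      by (intro mult_mono) auto
    then show ?thesis
      by (simp add: frac_laplacian_eq_second_difference[OF s f] abs_mult)
  qed
  define A where "A = ?c * K * (1 + 2 * r) powr ?q + ?c * (2 * M) * 4 powr ?q"
  have "\<bar>frac_laplacian s f x\<bar> \<le> A * (1 + norm x) powr (- ?q)" for x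
  proof (cases "norm x \<le> 2 * r")
    case True
    have "\<bar>frac_laplacian s f x\<bar> \<le> ?c * K"
      unfolding K_def
    proof (rule fl)
      show "integrable lborel (\<lambda>h::'a. C * (min 1 ((norm h)\<^sup>2) * ?k h))"
        using integrable_levy_kernel[OF s, where 'a = 'a] by simp
      show "\<bar>second_difference f x h * ?k h\<bar> \<le> C * (min 1 ((norm h)\<^sup>2) * ?k h)" for h
        using mult_right_mono[OF C(2)[of x h], of "?k h"] by (simp add: abs_mult mult.assoc)
    qed
    also have "\<dots> \<le> ?c * K * ((1 + 2 * r) powr ?q * (1 + norm x) powr (- ?q))"
    proof -
      have "(1 + norm x) powr ?q \<le> (1 + 2 * r) powr ?q"
        using True s by (intro powr_mono2) auto
      then have "1 \<le> (1 + 2 * r) powr ?q * (1 + norm x) powr (- ?q)"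
        using add_pos_nonneg[OF zero_less_one norm_ge_zero[of x]]
        by (simp add: powr_minus divide_inverse[symmetric] pos_le_divide_eq
            del: minus_add_distrib)
      then show ?thesis
        using mult_left_mono[of 1 _ "?c * K"] \<open>K \<ge> 0\<close> by simp
    qed
    also have "\<dots> \<le> A * (1 + norm x) powr (- ?q)"
      using \<open>M \<ge> 0\<close> by (simp add: A_def algebra_simps)
    finally show ?thesis .
  next
    case False
    define d where "d = 4 powr ?q * (1 + norm x) powr (- ?q)"
    let ?w = "\<lambda>h. (\<bar>f (x + 1 *\<^sub>R h)\<bar> + \<bar>f (x + (-1) *\<^sub>R h)\<bar>) * d"
    have i: "integrable lborel (\<lambda>y. \<bar>f y\<bar>)"
      using test_function_integrable[OF f] by simp
    have "\<bar>frac_laplacian s f x\<bar> \<le> ?c * (\<integral>h. ?w h \<partial>lborel)"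
    proof (rule fl)
      show "integrable lborel ?w"
        using lborel_integrable_affine[OF i, of 1 x] lborel_integrable_affine[OF i, of "-1" x]
        by (intro integrable_mult_left Bochner_Integration.integrable_add) auto
      fix h
      have kd: "?k h \<le> d" if "norm h \<ge> norm x / 2"
      proof -
        \<comment> \<open>$|x| \ge 1$ because $|x| > 2r$ and $r \ge 1$, so $(1 + |x|)/4 \le |x|/2$\<close>
        have "(1 + norm x) / 4 \<le> norm h" using that False r by simp
        then have "?k h \<le> ((1 + norm x) / 4) powr (- ?q)"
          using s by (intro powr_mono2') (auto simp: add_pos_nonneg)
        also have "\<dots> = d"
          by (simp add: d_def powr_divide powr_minus_divide[of 4] mult.commute del: minus_add_distrib)
        finally show ?thesis .
      qed
      have "f x = 0" using r False by auto
      then have "\<bar>second_difference f x h\<bar> \<le> \<bar>f (x + h)\<bar> + \<bar>f (x - h)\<bar>"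
        by (simp add: second_difference_def)
      moreover have "norm h \<ge> norm x / 2" if "f (x + h) \<noteq> 0 \<or> f (x - h) \<noteq> 0"
      proof -
        have "norm (x + h) \<le> r \<or> norm (x - h) \<le> r"
          using that r(2) by (metis not_less)
        then show ?thesis
          using False norm_triangle_ineq2[of x h] norm_triangle_ineq2[of x "-h"] by auto
      qed
      ultimately show "\<bar>second_difference f x h * ?k h\<bar> \<le> ?w h"
        using mult_mono[OF _ kd, of "\<bar>second_difference f x h\<bar>" "\<bar>f (x + h)\<bar> + \<bar>f (x - h)\<bar>"]
        by (cases "f (x + h) \<noteq> 0 \<or> f (x - h) \<noteq> 0") (auto simp: abs_mult)
    qed
    also have "(\<integral>h. ?w h \<partial>lborel) = 2 * M * d"
    proof -
      have "(\<integral>h. \<bar>f (x + c *\<^sub>R h)\<bar> \<partial>lborel) = M" if "c = 1 \<or> c = -1" for c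
        using lborel_integral_affine[of "\<lambda>y. \<bar>f y\<bar>" c x] that by (auto simp: M_def)
      moreover have "integrable lborel (\<lambda>h. \<bar>f (x + c *\<^sub>R h)\<bar>)" if "c = 1 \<or> c = -1" for c
        using lborel_integrable_affine[OF i, of c x] that by auto
      ultimately show ?thesis by (simp del: scaleR_minus1_left scaleR_one scaleR_minus_left)
    qed
    also have "?c * (2 * M * d) \<le> A * (1 + norm x) powr (- ?q)"
      using \<open>K \<ge> 0\<close> by (simp add: A_def d_def algebra_simps)
    finally show ?thesis .
  qed
  moreover have "A \<ge> 0" using \<open>K \<ge> 0\<close> \<open>M \<ge> 0\<close> by (simp add: A_def)
  ultimately show thesis by (intro that)
qed

text \<open>The operator is homogeneous of degree $2s$: substitute $c\,h$ for $h$ in the symmetrized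
  integral.\<close>

lemma frac_laplacian_scale:
  fixes f :: "'a::euclidean_space \<Rightarrow> real"
  assumes s: "0 < s" "s < 1" and f: "test_function f" and c: "c > 0"
  shows "frac_laplacian s (\<lambda>x. f (c *\<^sub>R x)) x = c powr (2 * s) * frac_laplacian s f (c *\<^sub>R x)"
proof -
  let ?q = "real DIM('a) + 2 * s"
  let ?g = "\<lambda>h. second_difference f (c *\<^sub>R x) h * norm h powr (- ?q)"
  have [measurable]: "f \<in> borel_measurable borel" using f by measurable
  have m: "?g \<in> borel_measurable borel" unfolding second_difference_def by measurable
  have cq: "c powr ?q * c powr (- ?q) = 1" using c by (simp flip: powr_add)
  have "(\<integral>h. second_difference (\<lambda>x. f (c *\<^sub>R x)) x h * norm h powr (- ?q) \<partial>lborel)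
      = (\<integral>h. c powr ?q * ?g (0 + c *\<^sub>R h) \<partial>lborel)"
    using c cq by (intro Bochner_Integration.integral_cong)
      (auto simp: second_difference_def powr_mult scaleR_add_right scaleR_diff_right)
  also have "\<dots> = c powr (2 * s) * (c ^ DIM('a) * (\<integral>h. ?g (0 + c *\<^sub>R h) \<partial>lborel))"
    using c by (simp add: powr_add powr_realpow)
  also have "c ^ DIM('a) * (\<integral>h. ?g (0 + c *\<^sub>R h) \<partial>lborel) = (\<integral>h. ?g h \<partial>lborel)"
    using lborel_integral_affine[OF m, of c 0] c by simp
  finally show ?thesis
    unfolding frac_laplacian_eq_second_difference[OF s f]
      frac_laplacian_eq_second_difference[OF s test_function_scale[OF f c]] by simp
qed

section \<open>Conservation of mass\<close>

text \<open>Young's inequality with exponents $1/m$ and $1/(1-m)$, weighted so that the second term carries an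
  arbitrarily small factor.\<close>

lemma Young_with_small_factor:
  fixes m \<delta> :: real
  assumes m: "0 < m" "m < 1" and \<delta>: "\<delta> > 0"
  obtains \<Lambda> where "\<Lambda> > 0"
    "\<And>a b. a \<ge> 0 \<Longrightarrow> b \<ge> 0 \<Longrightarrow> a powr m * b \<le> \<Lambda> * a + \<delta> * b powr (1 / (1 - m))"
proof -
  define \<Lambda> where "\<Lambda> = \<delta> powr (- (1 - m) / m)"
  have "\<Lambda> > 0" using \<delta> by (simp add: \<Lambda>_def)
  have "a powr m * b \<le> \<Lambda> * a + \<delta> * b powr (1 / (1 - m))" if ab: "a \<ge> 0" "b \<ge> 0" for a b
  proof (cases "a = 0 \<or> b = 0")
    case True
    then show ?thesis using ab \<open>\<Lambda> > 0\<close> \<delta> by auto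
  next
    case False
    with ab have pos: "a > 0" "b > 0" by auto
    let ?B = "\<delta> * b powr (1 / (1 - m))"
    have "(\<Lambda> * a) powr m * ?B powr (1 - m) \<le> m * (\<Lambda> * a) + (1 - m) * ?B"
      using m pos \<delta> \<open>\<Lambda> > 0\<close> by (intro Youngs_inequality_0) auto
    moreover have "(\<Lambda> * a) powr m * ?B powr (1 - m) = a powr m * b"
    proof -
      have "\<Lambda> powr m * \<delta> powr (1 - m) = 1"
        using m \<delta> by (simp add: \<Lambda>_def powr_powr flip: powr_add)
      then show ?thesis
        using m pos \<delta> \<open>\<Lambda> > 0\<close> by (simp add: powr_mult powr_powr)
    qed
    moreover have "m * (\<Lambda> * a) \<le> \<Lambda> * a" "(1 - m) * ?B \<le> ?B"
      using m pos \<delta> \<open>\<Lambda> > 0\<close> by (auto intro!: mult_left_le_one_le)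
    ultimately show ?thesis by linarith
  qed
  then show thesis using \<open>\<Lambda> > 0\<close> by (intro that)
qed

lemma abs_signed_power:
  assumes "m > 0"
  shows "\<bar>signed_power m r\<bar> = \<bar>r\<bar> powr m"
proof (cases "r = 0")
  case False
  then show ?thesis
    by (simp add: signed_power_def abs_mult powr_diff)
qed (simp add: signed_power_def)

text \<open>The equation is tested with $\varphi_n(x) = \varphi(c_n x)$, where $c_n \to 0$ and $\varphi(0) \ne 0$.
  The pairings $\int f\varphi_n$ converge to $\varphi(0)\int f$, so it suffices to show that
  $\int |w|^m\,|(-\Delta)^s\varphi_n| \to 0$. By scaling and decay,
  $|(-\Delta)^s\varphi_n(x)| \le a_n(x) := A\,c_n^{2s}\,G(c_n x)$ with
  $G(x) = (1 + |x|)^{-N-2s}$, which tends to zero pointwise.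

  The exponent is critical because $1/(1-m) = N/(2s)$: then $a_n^{1/(1-m)}$ is at most a constant
  times $H_n(x) := c_n^N\,G(c_n x)$, whose integral does not depend on \<open>n\<close>. Hoelder's inequality alone
  would thus only give boundedness. Young's inequality with a small factor $\delta$ gives
  $|w|^m a_n \le \Lambda |w| + C\delta H_n$. Hence the excess of $|w|^m a_n$ over $C\delta H_n$ is
  dominated by the integrable function $\Lambda |w|$, and it tends to zero pointwise, so its integral
  tends to zero. The rest contributes at most $C\delta\int G$, and $\delta$ is arbitrary.\<close>

lemma integral_frac_laplacian_eq_0:
  fixes s m :: real and w f :: "'a::euclidean_space \<Rightarrow> real"
  assumes s: "0 < s" "s < 1"
    and m: "m = (real DIM('a) - 2 * s) / real DIM('a)" "m > 0"
    and w: "integrable lebesgue w" and f: "integrable lebesgue f"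
    and eq: "has_frac_laplacian s (\<lambda>x. signed_power m (w x)) f"
  shows "(LINT x|lebesgue. f x) = 0"
proof -
  let ?N = "real DIM('a)"
  let ?q = "?N + 2 * s"
  define G where "G x = (1 + norm x) powr (- ?q)" for x :: 'a
  have G: "0 \<le> G x" "G x \<le> 1" for x
    using s powr_mono[of "- ?q" 0 "1 + norm x"] by (auto simp: G_def split: if_splits)
  have [measurable]: "G \<in> borel_measurable borel" unfolding G_def by measurable
  have G_int: "integrable lborel G"
    unfolding G_def using integrable_decay[OF s] by simp
  have m1: "m < 1" using s m by simp
  have "1 - m = 2 * s / ?N" using m(1) by (simp add: field_simps)
  then have exponent: "1 / (1 - m) = ?N / (2 * s)" by simp
  obtain \<phi> :: "'a \<Rightarrow> real" where \<phi>: "test_function \<phi>" "\<phi> 0 \<noteq> 0"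
    using ex_test_function_nonzero_at_0 by blast
  obtain A where A: "A \<ge> 0" "\<And>x. \<bar>frac_laplacian s \<phi> x\<bar> \<le> A * G x"
    using frac_laplacian_decay[OF s \<phi>(1)] unfolding G_def by metis
  obtain B where B: "B \<ge> 0" "\<And>x. \<bar>\<phi> x\<bar> \<le> B"
    using test_function_bounded[OF \<phi>(1)] by metis
  define c where "c n = 1 / (real n + 1)" for n
  have c: "c n > 0" for n by (simp add: c_def)
  have c_lim: "c \<longlonglongrightarrow> 0"
    unfolding c_def using LIMSEQ_inverse_real_of_nat by (simp add: inverse_eq_divide add.commute)
  define I where "I n = (LINT x|lebesgue. f x * \<phi> (c n *\<^sub>R x))" for n
  define a where "a n x = c n powr (2 * s) * (A * G (c n *\<^sub>R x))" for n and x :: 'a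
  define H where "H n x = c n ^ DIM('a) * G (0 + c n *\<^sub>R x)" for n and x :: 'a
  define F where "F n x = \<bar>w x\<bar> powr m * a n x" for n x
  have [measurable]: "w \<in> borel_measurable lebesgue" "f \<in> borel_measurable lebesgue"
    using w f by auto
  have lb: "g \<in> borel_measurable lebesgue" if "g \<in> borel_measurable borel" for g :: "'a \<Rightarrow> real"
    using that by (simp add: measurable_completion)
  have [measurable]: "H n \<in> borel_measurable lebesgue" "a n \<in> borel_measurable lebesgue" for n
    by (intro lb; unfold H_def a_def; measurable)+
  have [measurable]: "F n \<in> borel_measurable lebesgue" for n
    unfolding F_def by measurable
  have a0: "a n x \<ge> 0" and H0: "H n x \<ge> 0" and F0: "F n x \<ge> 0" for n x
    using A(1) G c[of n] by (auto simp: a_def H_def F_def)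

  have H_int: "integrable lebesgue (H n)" "(LINT x|lebesgue. H n x) = integral\<^sup>L lborel G" for n
  proof -
    have m: "H n \<in> borel_measurable lborel" unfolding H_def by measurable
    have "integrable lborel (H n)"
      unfolding H_def using lborel_integrable_affine[OF G_int, of "c n" 0] c[of n] by simp
    then show "integrable lebesgue (H n)" using m by (simp add: integrable_completion)
    have "(LINT x|lborel. H n x) = integral\<^sup>L lborel G"
      unfolding H_def using lborel_integral_affine[of G "c n" 0] c[of n] by simp
    then show "(LINT x|lebesgue. H n x) = integral\<^sup>L lborel G"
      using m by (simp add: integral_completion)
  qed

  \<comment> \<open>criticality of \<open>m\<close> enters here, through \<open>1 / (1 - m) = N / (2 * s)\<close>: $c_n^{2s \cdot N/(2s)} = c_n^N$\<close>
  have a_powr: "a n x powr (1 / (1 - m)) \<le> A powr (1 / (1 - m)) * H n x" for n x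
  proof -
    have "(c n powr (2 * s)) powr (1 / (1 - m)) = c n ^ DIM('a)"
      using s c[of n] by (simp add: exponent powr_powr powr_realpow)
    moreover have "G (c n *\<^sub>R x) powr (1 / (1 - m)) \<le> G (c n *\<^sub>R x)"
    proof (cases "G (c n *\<^sub>R x) = 0")
      case False
      then show ?thesis
        using G[of "c n *\<^sub>R x"] m1 m(2) powr_mono'[of 1 "1 / (1 - m)" "G (c n *\<^sub>R x)"]
        by (simp add: field_simps)
    qed simp
    ultimately show ?thesis
      using A(1) G(1)[of "c n *\<^sub>R x"] c[of n]
      by (simp add: a_def H_def powr_mult mult_left_mono mult.left_commute[of _ "A powr _"])
  qed

  have F_lim: "(\<lambda>n. F n x) \<longlonglongrightarrow> 0" for x
  proof (rule tendsto_sandwich[of "\<lambda>_. 0"])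
    show "\<forall>\<^sub>F n in sequentially. F n x \<le> \<bar>w x\<bar> powr m * (c n powr (2 * s) * (A * 1))"
      unfolding F_def a_def using A(1) G by (intro always_eventually allI mult_left_mono) auto
    have "(\<lambda>n. \<bar>w x\<bar> powr m * (c n powr (2 * s) * (A * 1))) \<longlonglongrightarrow> \<bar>w x\<bar> powr m * (0 * (A * 1))"
      using s c by (intro tendsto_intros tendsto_zero_powrI[OF c_lim, of _ "2 * s"])
        (auto intro!: always_eventually less_imp_le)
    then show "(\<lambda>n. \<bar>w x\<bar> powr m * (c n powr (2 * s) * (A * 1))) \<longlonglongrightarrow> 0" by simp
  qed (auto simp: F0)

  \<comment> \<open>a non-integrable product has integral 0 by convention, which satisfies the bound as well\<close>
  have I_le: "\<bar>I n\<bar> \<le> (LINT x|lebesgue. F n x)" if "integrable lebesgue (F n)" for n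
  proof -
    let ?L = "\<lambda>x. signed_power m (w x) * frac_laplacian s (\<lambda>x. \<phi> (c n *\<^sub>R x)) x"
    have "I n = (LINT x|lebesgue. ?L x)"
      using eq test_function_scale[OF \<phi>(1) c[of n]]
      unfolding has_frac_laplacian_def I_def by metis
    moreover have "\<bar>?L x\<bar> \<le> F n x" for x
      unfolding F_def a_def frac_laplacian_scale[OF s \<phi>(1) c]
      using A(2) by (auto simp: abs_mult abs_signed_power[OF m(2)] intro!: mult_left_mono)
    ultimately show ?thesis
      using Bochner_Integration.integral_abs_bound_integral[OF _ that, of ?L] F0
      by (cases "integrable lebesgue ?L") (auto simp: not_integrable_integral_eq)
  qed

  have I_lim: "I \<longlonglongrightarrow> (LINT x|lebesgue. f x * \<phi> 0)"
    unfolding I_def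
  proof (rule integral_dominated_convergence[where w = "\<lambda>x. B * \<bar>f x\<bar>"])
    have [measurable]: "(\<lambda>x. \<phi> (c n *\<^sub>R x)) \<in> borel_measurable lebesgue" for n
      by (intro lb test_function_borel_measurable test_function_scale \<phi>(1) c)
    show "(\<lambda>x. f x * \<phi> (c n *\<^sub>R x)) \<in> borel_measurable lebesgue" for n by measurable
    have "(\<lambda>n. \<phi> (c n *\<^sub>R x)) \<longlonglongrightarrow> \<phi> 0" for x
      using continuous_on_tendsto_compose[OF test_function_continuous[OF \<phi>(1), of UNIV]
          tendsto_scaleR[OF c_lim tendsto_const[of x]]] by simp
    then show "AE x in lebesgue. (\<lambda>n. f x * \<phi> (c n *\<^sub>R x)) \<longlonglongrightarrow> f x * \<phi> 0"
      by (auto intro!: tendsto_intros)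
    show "AE x in lebesgue. norm (f x * \<phi> (c n *\<^sub>R x)) \<le> B * \<bar>f x\<bar>" for n
      using B(2) by (auto simp: abs_mult mult.commute[of B] intro!: mult_left_mono)
  qed (use f in auto)

  have small: "\<bar>LINT x|lebesgue. f x * \<phi> 0\<bar> \<le> \<delta> * (A powr (1 / (1 - m)) * integral\<^sup>L lborel G)"
    if \<delta>: "\<delta> > 0" for \<delta>
  proof -
    obtain \<Lambda> where \<Lambda>: "\<Lambda> > 0"
      "\<And>a b. a \<ge> 0 \<Longrightarrow> b \<ge> 0 \<Longrightarrow> a powr m * b \<le> \<Lambda> * a + \<delta> * b powr (1 / (1 - m))"
      using Young_with_small_factor[OF m(2) m1 \<delta>] by metis
    let ?d = "\<delta> * A powr (1 / (1 - m))"
    have d0: "?d \<ge> 0" using \<delta> by simp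
    have FH: "F n x \<le> \<Lambda> * \<bar>w x\<bar> + ?d * H n x" for n x
    proof -
      have "F n x \<le> \<Lambda> * \<bar>w x\<bar> + \<delta> * a n x powr (1 / (1 - m))"
        unfolding F_def using a0 by (intro \<Lambda>(2)) auto
      moreover have "\<delta> * a n x powr (1 / (1 - m)) \<le> \<delta> * (A powr (1 / (1 - m)) * H n x)"
        using \<delta> by (intro mult_left_mono a_powr) auto
      ultimately show ?thesis by (simp only: mult.assoc)
    qed
    have Fi: "integrable lebesgue (F n)" for n
    proof (rule Bochner_Integration.integrable_bound)
      show "integrable lebesgue (\<lambda>x. \<Lambda> * \<bar>w x\<bar> + ?d * H n x)"
        using w H_int by simp
      show "AE x in lebesgue. norm (F n x) \<le> norm (\<Lambda> * \<bar>w x\<bar> + ?d * H n x)"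
        using FH F0 by (intro always_eventually allI) (use order_trans[OF F0 FH] in auto)
    qed simp
    \<comment> \<open>the excess over the part that carries the small factor\<close>
    let ?E = "\<lambda>n x. max 0 (F n x - ?d * H n x)"
    have E_lim: "(\<lambda>n. LINT x|lebesgue. ?E n x) \<longlonglongrightarrow> integral\<^sup>L lebesgue (\<lambda>_::'a. 0)"
    proof (rule integral_dominated_convergence[where w = "\<lambda>x. \<Lambda> * \<bar>w x\<bar>"])
      show "AE x in lebesgue. norm (?E n x) \<le> \<Lambda> * \<bar>w x\<bar>" for n
        using FH[of n] \<Lambda>(1) by (intro always_eventually allI) (auto simp: algebra_simps)
      show "AE x in lebesgue. (\<lambda>n. ?E n x) \<longlonglongrightarrow> 0"
      proof (intro always_eventually allI)
        fix x
        have "?E n x \<le> F n x" for n using d0 H0 F0 by simp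
        then show "(\<lambda>n. ?E n x) \<longlonglongrightarrow> 0"
          by (intro tendsto_sandwich[OF _ _ tendsto_const F_lim[of x]]) auto
      qed
    qed (use w in auto)
    have Ei: "integrable lebesgue (?E n)" for n
      using Fi H_int by (intro integrable_max) auto
    have "\<bar>I n\<bar> \<le> (LINT x|lebesgue. ?E n x) + ?d * integral\<^sup>L lborel G" for n
    proof -
      have "(LINT x|lebesgue. F n x) \<le> (LINT x|lebesgue. ?E n x + ?d * H n x)"
        using Fi Ei H_int by (intro integral_mono) auto
      also have "\<dots> = (LINT x|lebesgue. ?E n x) + ?d * integral\<^sup>L lborel G"
        using Ei H_int by simp
      finally show ?thesis using I_le[OF Fi, of n] by linarith
    qed
    moreover have "(\<lambda>n. (LINT x|lebesgue. ?E n x) + ?d * integral\<^sup>L lborel G)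
        \<longlonglongrightarrow> 0 + ?d * integral\<^sup>L lborel G"
      using E_lim by (intro tendsto_intros) simp
    ultimately have "\<bar>LINT x|lebesgue. f x * \<phi> 0\<bar> \<le> 0 + ?d * integral\<^sup>L lborel G"
      using tendsto_rabs[OF I_lim] by (intro tendsto_le[OF sequentially_bot]) auto
    then show ?thesis by (simp add: mult.assoc)
  qed

  have "\<bar>LINT x|lebesgue. f x * \<phi> 0\<bar> \<le> 0"
  proof (rule tendsto_lowerbound)
    show "((\<lambda>\<delta>. \<delta> * (A powr (1 / (1 - m)) * integral\<^sup>L lborel G)) \<longlongrightarrow> 0) (at_right 0)"
      by (auto intro!: tendsto_eq_intros)
    show "\<forall>\<^sub>F \<delta> in at_right 0. \<bar>LINT x|lebesgue. f x * \<phi> 0\<bar> \<le> \<delta> * (A powr (1 / (1 - m)) * integral\<^sup>L lborel G)"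
      using small by (auto simp: eventually_at_filter)
  qed simp
  then show ?thesis using \<phi>(2) by simp
qed

text \<open>Each step changes the mass by \<open>h\<close> times the integral of a fractional Laplacian, which vanishes.\<close>

lemma implicit_scheme_mass:
  fixes s m h :: real and u0 :: "'a::euclidean_space \<Rightarrow> real"
  assumes s: "0 < s" "s < 1"
    and m: "m = (real DIM('a) - 2 * s) / real DIM('a)" "m > 0"
    and u0: "integrable lebesgue u0" and h: "h > 0"
    and U: "implicit_scheme s m u0 h n U" and k: "k \<le> n"
  shows "integrable lebesgue (U k) \<and> (LINT x|lebesgue. U k x) = (LINT x|lebesgue. u0 x)"
  using k
proof (induction k)
  case 0
  then show ?case using U u0 by (simp add: implicit_scheme_def)
next
  case (Suc k)
  then have op: "fpme_operator s m (U (Suc k)) (\<lambda>x. (U k x - U (Suc k) x) / h)"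
    using U by (simp add: implicit_scheme_def)
  then have "(LINT x|lebesgue. (U k x - U (Suc k) x) / h) = 0"
    by (intro integral_frac_laplacian_eq_0[OF s m]) (auto simp: fpme_operator_def)
  moreover have "integrable lebesgue (U (Suc k))" using op by (simp add: fpme_operator_def)
  ultimately show ?case using Suc h by simp
qed

theorem theorem12p1:
  fixes s m :: real
    and u0 :: "'a::euclidean_space \<Rightarrow> real"
    and u :: "real \<Rightarrow> 'a \<Rightarrow> real"
  assumes "0 < s" and "s < 1"
    and "m = (real DIM('a) - 2 * s) / real DIM('a)" and "m > 0"
    and "integrable lebesgue u0" and "AE x in lebesgue. u0 x \<ge> 0"
    and "semigroup_solution s m u0 u"
    and "\<forall>t\<ge>0. AE x in lebesgue. u t x \<ge> 0"
  shows "\<forall>t>0. (LINT x|lebesgue. u t x) = (LINT x|lebesgue. u0 x)"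
proof (intro allI impI)
  fix t :: real
  assume t: "t > 0"
  have u: "integrable lebesgue (u t)"
    using assms(7) t by (simp add: semigroup_solution_def)
  obtain U :: "nat \<Rightarrow> nat \<Rightarrow> 'a \<Rightarrow> real"
    where U: "\<And>n. n \<ge> 1 \<Longrightarrow> implicit_scheme s m u0 (t / real n) n (U n)"
      and lim: "uniform_limit {0..t}
        (\<lambda>n \<tau>. L1_dist (U n (nat \<lceil>\<tau> / (t / real n)\<rceil>)) (u \<tau>)) (\<lambda>\<tau>. 0) sequentially"
    using assms(7) t unfolding semigroup_solution_def by blast
  \<comment> \<open>with final time \<open>T = t\<close>, the interpolant at time \<open>t\<close> is the last iterate \<open>U n n\<close>\<close>
  have "(\<lambda>n. L1_dist (U n (nat \<lceil>t / (t / real n)\<rceil>)) (u t)) \<longlonglongrightarrow> 0"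
    using tendsto_uniform_limitI[OF lim, of t] t by simp
  then have lim': "(\<lambda>n. L1_dist (U n n) (u t)) \<longlonglongrightarrow> 0"
    using t by simp
  have "\<bar>(LINT x|lebesgue. u0 x) - (LINT x|lebesgue. u t x)\<bar> \<le> L1_dist (U n n) (u t)"
    if "n \<ge> 1" for n
  proof -
    have Un: "integrable lebesgue (U n n)" "(LINT x|lebesgue. U n n x) = (LINT x|lebesgue. u0 x)"
      using implicit_scheme_mass[OF assms(1-5) _ U[OF that], of n] t that by auto
    have "(LINT x|lebesgue. u0 x) - (LINT x|lebesgue. u t x) = (LINT x|lebesgue. U n n x - u t x)"
      using Un u by simp
    then show ?thesis
      by (simp add: L1_dist_def)
  qed
  then have "\<bar>(LINT x|lebesgue. u0 x) - (LINT x|lebesgue. u t x)\<bar> \<le> 0"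
    by (intro tendsto_lowerbound[OF lim'])
      (auto simp: eventually_sequentially)
  then show "(LINT x|lebesgue. u t x) = (LINT x|lebesgue. u0 x)" by simp
qed

end
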